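(* Consider the following constraints on $(x,s,\theta)$ with $x\in Q$, $s\in\{0,1\}^{p\times p}$, $\theta\in\mathbb{R}^p$: (b) $\sum_{i\in P}s_{ij}=j-1$ for all $j\in P$; (b$_\le$) $\sum_{i\in P}s_{ij}\le j-1$ for all $j\in P$; (c) $s_{i,j+1}-s_{ij}\ge 0$ for all $i,j\in P$, $j<p$; (d) $C^i x\le\theta_j+M s_{ij}$ for all $i,j\in P$; (e) $\theta_j\ge\theta_{j+1}$ for all $j\in P$, $j<p$. Let $\Omega^s$ be the set of such $(x,s,\theta)$ satisfying (b), (c), (d), (e); $\Omega^s_{R1}$ those satisfying (b), (c), (d); $\Omega^s_{R2}$ those satisfying (b), (d); and $\Omega^s_{R3}$ those satisfying (b$_\le$), (d). Let $F^s$, $F^s_{R1}$, $F^s_{R2}$, $F^s_{R3}$ be the problems of minimizing $\sum_{j\in P}\omega_j\theta_j$ over $\Omega^s$, $\Omega^s_{R1}$, $\Omega^s_{R2}$, $\Omega^s_{R3}$, respectively. Then: 1. Every optimal solution to $F^s_{R1}$ is optimal to $F^s$ and conversely. 2. Every optimal solution to $F^s_{R2}$ is optimal to $F^s$ and conversely. 3. Every optimal solution to $F^s_{R3}$ is optimal to $F^s$ and conversely. 4. $\Omega^s\subsetneq\Omega^s_{R1}\subsetneq\Omega^s_{R2}\subsetneq\Omega^s_{R3}$.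
   Context: $P=\{1,\dots,p\}$. $Q\subseteq\mathbb{R}^n$ is the feasible set of a combinatorial optimization problem (a combinatorial object representable by a system of linear inequalities). $C\in\mathbb{R}^{p\times n}$ is a matrix whose rows $C^i$, $i\in P$, are the cost vectors of $p$ objective (cost) functions $x\mapsto C^i x$. $\omega=(\omega_j)_{j\in P}$ is a vector of non-negative weights. $M$ is a non-negative upper bound on the value of all the cost functions, i.e. $M\ge 0$ and $C^i x\le M$ for all $x\in Q$, $i\in P$.
   Formalization: Relaxed-to-full in 1–3 fails for triples (zero weights, ties): proved instead is that x and each θ_j with ω_j>0 (for R1 also s) extend to an optimum of F^s. Strictness in 4 is proved for Q nonempty and p≥2 (p≥3 for the middle inclusion); otherwise only inclusion. *)

theory Defs
  imports "HOL-Analysis.Analysis"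
begin

text \<open>
  The index set is \<open>P = {1..p}\<close>. Vectors indexed by \<open>P\<close> and matrices indexed by
  \<open>P \<times> P\<close> are extensional functions on \<open>nat\<close>, so that each of them is represented
  exactly once and comparisons of feasible sets are not affected by values outside \<open>P\<close>.
  Rows of the cost matrix are \<open>C i :: real ^ 'n\<close> for \<open>i \<in> P\<close>.
\<close>

type_synonym 'n point = "(real ^ 'n) \<times> (nat \<Rightarrow> nat \<Rightarrow> real) \<times> (nat \<Rightarrow> real)"

definition domain_s :: "nat \<Rightarrow> (real ^ 'n) set \<Rightarrow> 'n point set" where
  "domain_s p Q = Q \<times> ({1..p} \<rightarrow>\<^sub>E {1..p} \<rightarrow>\<^sub>E {0, 1}) \<times> ({1..p} \<rightarrow>\<^sub>E UNIV)"

definition constr_b :: "nat \<Rightarrow> (nat \<Rightarrow> nat \<Rightarrow> real) \<Rightarrow> bool" where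
  "constr_b p s \<longleftrightarrow> (\<forall>j\<in>{1..p}. (\<Sum>i\<in>{1..p}. s i j) = real j - 1)"

definition constr_b_le :: "nat \<Rightarrow> (nat \<Rightarrow> nat \<Rightarrow> real) \<Rightarrow> bool" where
  "constr_b_le p s \<longleftrightarrow> (\<forall>j\<in>{1..p}. (\<Sum>i\<in>{1..p}. s i j) \<le> real j - 1)"

definition constr_c :: "nat \<Rightarrow> (nat \<Rightarrow> nat \<Rightarrow> real) \<Rightarrow> bool" where
  "constr_c p s \<longleftrightarrow> (\<forall>i\<in>{1..p}. \<forall>j\<in>{1..p}. j < p \<longrightarrow> s i (j + 1) - s i j \<ge> 0)"

definition constr_d ::
    "nat \<Rightarrow> (nat \<Rightarrow> real ^ 'n) \<Rightarrow> real \<Rightarrow> real ^ 'n \<Rightarrow> (nat \<Rightarrow> nat \<Rightarrow> real) \<Rightarrow> (nat \<Rightarrow> real) \<Rightarrow> bool" where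
  "constr_d p C M x s \<theta> \<longleftrightarrow> (\<forall>i\<in>{1..p}. \<forall>j\<in>{1..p}. C i \<bullet> x \<le> \<theta> j + M * s i j)"

definition constr_e :: "nat \<Rightarrow> (nat \<Rightarrow> real) \<Rightarrow> bool" where
  "constr_e p \<theta> \<longleftrightarrow> (\<forall>j\<in>{1..p}. j < p \<longrightarrow> \<theta> j \<ge> \<theta> (j + 1))"

definition Omega_s :: "nat \<Rightarrow> (real ^ 'n) set \<Rightarrow> (nat \<Rightarrow> real ^ 'n) \<Rightarrow> real \<Rightarrow> 'n point set" where
  "Omega_s p Q C M = {(x, s, \<theta>) \<in> domain_s p Q.
     constr_b p s \<and> constr_c p s \<and> constr_d p C M x s \<theta> \<and> constr_e p \<theta>}"

definition Omega_s_R1 :: "nat \<Rightarrow> (real ^ 'n) set \<Rightarrow> (nat \<Rightarrow> real ^ 'n) \<Rightarrow> real \<Rightarrow> 'n point set" where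
  "Omega_s_R1 p Q C M = {(x, s, \<theta>) \<in> domain_s p Q.
     constr_b p s \<and> constr_c p s \<and> constr_d p C M x s \<theta>}"

definition Omega_s_R2 :: "nat \<Rightarrow> (real ^ 'n) set \<Rightarrow> (nat \<Rightarrow> real ^ 'n) \<Rightarrow> real \<Rightarrow> 'n point set" where
  "Omega_s_R2 p Q C M = {(x, s, \<theta>) \<in> domain_s p Q.
     constr_b p s \<and> constr_d p C M x s \<theta>}"

definition Omega_s_R3 :: "nat \<Rightarrow> (real ^ 'n) set \<Rightarrow> (nat \<Rightarrow> real ^ 'n) \<Rightarrow> real \<Rightarrow> 'n point set" where
  "Omega_s_R3 p Q C M = {(x, s, \<theta>) \<in> domain_s p Q.
     constr_b_le p s \<and> constr_d p C M x s \<theta>}"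

definition objective :: "nat \<Rightarrow> (nat \<Rightarrow> real) \<Rightarrow> 'n point \<Rightarrow> real" where
  "objective p \<omega> = (\<lambda>(x, s, \<theta>). \<Sum>j\<in>{1..p}. \<omega> j * \<theta> j)"

definition optimal :: "nat \<Rightarrow> (nat \<Rightarrow> real) \<Rightarrow> 'n point set \<Rightarrow> 'n point \<Rightarrow> bool" where
  "optimal p \<omega> \<Omega> z \<longleftrightarrow> is_arg_min (objective p \<omega>) (\<lambda>z. z \<in> \<Omega>) z"

text \<open>
  Optimal solutions of a relaxation are compared with those of the full problem as follows.
  An optimal triple of the full problem is optimal for each relaxation as it stands. In the
  other direction the triple itself need not be feasible for the full problem: an entry
  \<open>\<theta> j\<close> with \<open>\<omega> j = 0\<close> is not determined by optimality, so (e) can fail, and without (c)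
  or with (b) relaxed the sorting matrix \<open>s\<close> is not determined either (for instance when
  cost values are tied), so (b) or (c) can fail. The solution \<open>x\<close> is always kept, and so is
  every \<open>\<theta> j\<close> with \<open>\<omega> j > 0\<close>. The relaxation R1, which has both (b) and (c), keeps
  \<open>s\<close> as well; thus for positive weights its optimal triples are exactly those of the full
  problem.
\<close>

end

(*
  For a fixed x and a fixed s, the cheapest choice of theta under (d) is
  theta_j = max_i (C^i x - M s_ij), and (c) makes this choice nonincreasing in j.
  Let s be the matrix whose column j marks the j - 1 largest costs. Then theta_j is
  max (v_j, v_1 - M), where v_1 >= ... >= v_p are the sorted costs, and no other column with
  at most j - 1 ones does better: some i among the j largest costs is left unmarked, so
  theta_j >= v_j, and theta_j >= v_1 - M holds in any case. Hence every point of the weakest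
  relaxation is dominated, componentwise in theta, by a point of Omega^s with the same x.
*)
theory Submission
  imports Defs
begin

declare One_nat_def [simp del]

section \<open>Zero-one matrices and their column sums\<close>

text \<open>The matrix whose column \<open>j\<close> is the indicator of the set \<open>A j\<close>.
  Both restrictions yield \<open>undefined\<close> outside \<open>{1..p}\<close>, as the extensional
  domain of \<open>s\<close> in \<open>domain_s\<close> demands.\<close>

definition incidence :: "nat \<Rightarrow> (nat \<Rightarrow> nat set) \<Rightarrow> nat \<Rightarrow> nat \<Rightarrow> real" where
  "incidence p A = (\<lambda>i\<in>{1..p}. \<lambda>j\<in>{1..p}. if i \<in> A j then 1 else 0)"

lemma incidence_apply:
  "i \<in> {1..p} \<Longrightarrow> j \<in> {1..p} \<Longrightarrow> incidence p A i j = (if i \<in> A j then 1 else 0)"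
  by (simp add: incidence_def)

lemma incidence_mem: "incidence p A \<in> {1..p} \<rightarrow>\<^sub>E {1..p} \<rightarrow>\<^sub>E {0, 1}"
  by (auto simp: incidence_def PiE_def)

lemma sum_zero_one_eq_card:
  fixes f :: "'a \<Rightarrow> real"
  assumes "finite I" "\<And>i. i \<in> I \<Longrightarrow> f i \<in> {0, 1}"
  shows "(\<Sum>i\<in>I. f i) = card {i \<in> I. f i = 1}"
proof -
  have "(\<Sum>i\<in>I. f i) = (\<Sum>i\<in>I. if f i = 1 then 1 else 0)"
    using assms(2) by (intro sum.cong) fastforce+
  then show ?thesis
    using assms(1) by (simp add: sum.If_cases Int_def)
qed

lemma sum_incidence:
  assumes "j \<in> {1..p}"
  shows "(\<Sum>i\<in>{1..p}. incidence p A i j) = card ({1..p} \<inter> A j)"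
proof -
  have "{i \<in> {1..p}. incidence p A i j = 1} = {1..p} \<inter> A j"
    using assms by (auto simp: incidence_apply split: if_splits)
  then show ?thesis
    using sum_zero_one_eq_card[of "{1..p}" "\<lambda>i. incidence p A i j"] assms
    by (simp add: incidence_apply)
qed

lemma constr_b_incidence:
  assumes "\<And>j. j \<in> {1..p} \<Longrightarrow> card ({1..p} \<inter> A j) = j - 1"
  shows "constr_b p (incidence p A)"
  using assms by (auto simp: constr_b_def sum_incidence of_nat_diff)

section \<open>Ranking the indices by value\<close>

text \<open>Sorting by \<open>- v\<close> lists the indices by nonincreasing value, and
  \<open>r i\<close> is the position of \<open>i\<close> in this list. Tied values still get
  distinct ranks, so the number of indices of rank at most m is exact.\<close>

lemma decreasing_ranking:
  fixes v :: "nat \<Rightarrow> real"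
  obtains r where "bij_betw r {1..p} {1..p}"
    "\<And>i k. i \<in> {1..p} \<Longrightarrow> k \<in> {1..p} \<Longrightarrow> r k \<le> r i \<Longrightarrow> v i \<le> v k"
proof -
  define xs where "xs = sort_key (\<lambda>i. - v i) [1..<Suc p]"
  have xs: "distinct xs" "set xs = {1..p}" "length xs = p" "sorted (map (\<lambda>i. - v i) xs)"
    by (auto simp: xs_def)
  \<comment> \<open>List positions start at 0 and ranks at 1; \<open>f\<close> sends a rank to the
    index that has it.\<close>
  define f where "f = (!) xs \<circ> (\<lambda>k. k - 1)"
  have "bij_betw (\<lambda>k::nat. k - 1) {1..p} {..<p}"
    by (rule bij_betw_byWitness[where f' = Suc]) auto
  moreover have "bij_betw ((!) xs) {..<p} {1..p}"
    using xs by (intro bij_betw_nth) auto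
  ultimately have f: "bij_betw f {1..p} {1..p}"
    unfolding f_def by (rule bij_betw_trans)
  have mono: "v (f a) \<ge> v (f b)" if "1 \<le> a" "a \<le> b" "b \<le> p" for a b
    using sorted_nth_mono[OF xs(4), of "a - 1" "b - 1"] that xs(3) by (simp add: f_def)
  define r where "r = inv_into {1..p} f"
  have r: "bij_betw r {1..p} {1..p}"
    unfolding r_def using f by (rule bij_betw_inv_into)
  have fr: "f (r i) = i" if "i \<in> {1..p}" for i
    unfolding r_def using bij_betw_inv_into_right[OF f that] .
  show ?thesis
  proof (rule that[OF r])
    fix i k assume ik: "i \<in> {1..p}" "k \<in> {1..p}" "r k \<le> r i"
    then have "r k \<in> {1..p}" "r i \<in> {1..p}"
      using r bij_betwE by blast+
    then show "v i \<le> v k"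
      using mono[of "r k" "r i"] ik fr by simp
  qed
qed

lemma card_ranked_le:
  assumes "bij_betw r {1..p} {1..p}" "m \<le> p"
  shows "card ({1..p} \<inter> {i. r i \<le> m}) = m"
proof -
  have "r ` ({1..p} \<inter> {i. r i \<le> m}) = {1..m}"
  proof -
    have "r ` ({1..p} \<inter> {i. r i \<le> m}) = r ` {1..p} \<inter> {..m}"
      by auto
    then show ?thesis
      using assms by (auto simp: bij_betw_def)
  qed
  moreover have "inj_on r ({1..p} \<inter> {i. r i \<le> m})"
    using assms(1) by (auto simp: bij_betw_def intro: inj_on_subset)
  ultimately show ?thesis
    by (metis card_image card_atLeastAtMost diff_Suc_1)
qed

section \<open>The least feasible \<theta> for fixed x and s\<close>

definition least_theta ::
    "nat \<Rightarrow> (nat \<Rightarrow> real ^ 'n) \<Rightarrow> real \<Rightarrow> real ^ 'n \<Rightarrow> (nat \<Rightarrow> nat \<Rightarrow> real) \<Rightarrow> nat \<Rightarrow> real" where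
  "least_theta p C M x s = (\<lambda>j\<in>{1..p}. Max ((\<lambda>i. C i \<bullet> x - M * s i j) ` {1..p}))"

text \<open>A member \<open>j\<close> of \<open>{1..p}\<close> makes this interval nonempty, so
  \<open>Max\<close> is a true maximum.\<close>

lemma least_theta_le_iff:
  assumes "j \<in> {1..p}"
  shows "least_theta p C M x s j \<le> t \<longleftrightarrow> (\<forall>i\<in>{1..p}. C i \<bullet> x - M * s i j \<le> t)"
  using assms by (simp add: least_theta_def)

lemma constr_d_iff:
  "constr_d p C M x s \<theta> \<longleftrightarrow> (\<forall>j\<in>{1..p}. least_theta p C M x s j \<le> \<theta> j)"
  by (auto simp: constr_d_def least_theta_le_iff algebra_simps)

text \<open>As \<open>M\<close> is non-negative, (c) makes every term of the maximum nonincreasing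
  in j, hence also the maximum.\<close>

lemma constr_e_least_theta:
  assumes "0 \<le> M" "constr_c p s"
  shows "constr_e p (least_theta p C M x s)"
  unfolding constr_e_def
proof (intro ballI impI)
  fix j assume j: "j \<in> {1..p}" "j < p"
  have "C i \<bullet> x - M * s i (j + 1) \<le> least_theta p C M x s j" if "i \<in> {1..p}" for i
  proof -
    have "s i j \<le> s i (j + 1)"
      using assms(2) j that by (auto simp: constr_c_def)
    then have "M * s i j \<le> M * s i (j + 1)"
      using assms(1) by (rule mult_left_mono)
    moreover have "C i \<bullet> x - M * s i j \<le> least_theta p C M x s j"
      using least_theta_le_iff[OF j(1)] that by blast
    ultimately show ?thesis
      by linarith
  qed
  then show "least_theta p C M x s (j + 1) \<le> least_theta p C M x s j"
    using j by (subst least_theta_le_iff) auto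
qed

lemma least_theta_in_Omega_s:
  assumes "0 \<le> M" "x \<in> Q" "s \<in> {1..p} \<rightarrow>\<^sub>E {1..p} \<rightarrow>\<^sub>E {0, 1}" "constr_b p s" "constr_c p s"
  shows "(x, s, least_theta p C M x s) \<in> Omega_s p Q C M"
proof -
  have "least_theta p C M x s \<in> {1..p} \<rightarrow>\<^sub>E UNIV"
    by (simp add: least_theta_def)
  then show ?thesis
    using assms by (simp add: Omega_s_def domain_s_def constr_d_iff constr_e_least_theta)
qed

section \<open>Inclusions, and domination by points of the full problem\<close>

lemma Omega_s_subset_R1: "Omega_s p Q C M \<subseteq> Omega_s_R1 p Q C M"
  by (auto simp: Omega_s_def Omega_s_R1_def)

lemma Omega_s_R1_subset_R2: "Omega_s_R1 p Q C M \<subseteq> Omega_s_R2 p Q C M"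
  by (auto simp: Omega_s_R1_def Omega_s_R2_def)

lemma Omega_s_R2_subset_R3: "Omega_s_R2 p Q C M \<subseteq> Omega_s_R3 p Q C M"
  by (auto simp: Omega_s_R2_def Omega_s_R3_def constr_b_def constr_b_le_def)

text \<open>Here \<open>s\<close> already satisfies (b) and (c), so lowering \<theta> to its least
  value restores (e) without touching \<open>s\<close>.\<close>

lemma Omega_s_R1_dominated:
  assumes "0 \<le> M" "(x, s, \<theta>) \<in> Omega_s_R1 p Q C M"
  shows "\<exists>\<theta>'. (x, s, \<theta>') \<in> Omega_s p Q C M \<and> (\<forall>j\<in>{1..p}. \<theta>' j \<le> \<theta> j)"
proof (intro exI conjI)
  show "(x, s, least_theta p C M x s) \<in> Omega_s p Q C M"
    using assms by (intro least_theta_in_Omega_s) (auto simp: Omega_s_R1_def domain_s_def)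
  show "\<forall>j\<in>{1..p}. least_theta p C M x s j \<le> \<theta> j"
    using assms(2) by (simp add: Omega_s_R1_def constr_d_iff)
qed

lemma Omega_s_R3_dominated:
  assumes M: "0 \<le> M" and z: "(x, s, \<theta>) \<in> Omega_s_R3 p Q C M"
  shows "\<exists>s' \<theta>'. (x, s', \<theta>') \<in> Omega_s p Q C M \<and> (\<forall>j\<in>{1..p}. \<theta>' j \<le> \<theta> j)"
proof -
  obtain r where r: "bij_betw r {1..p} {1..p}"
    "\<And>i k. i \<in> {1..p} \<Longrightarrow> k \<in> {1..p} \<Longrightarrow> r k \<le> r i \<Longrightarrow> C i \<bullet> x \<le> C k \<bullet> x"
    using decreasing_ranking[of p "\<lambda>i. C i \<bullet> x"] by blast
  \<comment> \<open>Ranks start at 1, so column 1 is zero and column \<open>j\<close> marks exactly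
    the first \<open>j - 1\<close> ranks. These sets grow with \<open>j\<close>, which gives
    (c).\<close>
  define s' where "s' = incidence p (\<lambda>j. {i. r i \<le> j - 1})"
  have "constr_b p s'"
    unfolding s'_def by (intro constr_b_incidence card_ranked_le r) auto
  moreover have "constr_c p s'"
    by (auto simp: s'_def constr_c_def incidence_apply)
  ultimately have "(x, s', least_theta p C M x s') \<in> Omega_s p Q C M"
    using M z by (intro least_theta_in_Omega_s)
      (auto simp: Omega_s_R3_def domain_s_def s'_def incidence_mem)
  moreover have "least_theta p C M x s' j \<le> \<theta> j" if j: "j \<in> {1..p}" for j
    unfolding least_theta_le_iff[OF j]
  proof
    fix i assume i: "i \<in> {1..p}"
    have "s \<in> {1..p} \<rightarrow>\<^sub>E {1..p} \<rightarrow>\<^sub>E {0, 1}"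
      using z by (simp add: Omega_s_R3_def domain_s_def)
    then have s01: "s k j \<in> {0, 1}" if "k \<in> {1..p}" for k
      using j that by (metis PiE_mem)
    have d: "C k \<bullet> x \<le> \<theta> j + M * s k j" if "k \<in> {1..p}" for k
      using z j that by (auto simp: Omega_s_R3_def constr_d_def)
    show "C i \<bullet> x - M * s' i j \<le> \<theta> j"
    proof (cases "r i \<le> j - 1")
      \<comment> \<open>A marked entry subtracts the full \<open>M\<close>, the most that any
        zero-one matrix can subtract, so (d) for \<open>s\<close> at the same \<open>i\<close>
        suffices.\<close>
      case True
      then have "s' i j = 1"
        using i j by (simp add: s'_def incidence_apply)
      moreover have "M * s i j \<le> M"
        using M s01[OF i] by auto
      ultimately show ?thesis
        using d[OF i] by simp
    next
      \<comment> \<open>Pigeonhole: at least \<open>j\<close> indices rank no later than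
        \<open>i\<close>, but column \<open>j\<close> of \<open>s\<close> has at most
        \<open>j - 1\<close> ones. Some such \<open>k\<close> is unmarked in \<open>s\<close>, and
        its cost is at least that of \<open>i\<close>.\<close>
      case False
      have "r i \<in> {1..p}"
        using r(1) i bij_betwE by blast
      then have ri: "card ({1..p} \<inter> {k. r k \<le> r i}) = r i"
        using card_ranked_le[OF r(1)] by simp
      have "(\<Sum>k\<in>{1..p}. s k j) \<le> real j - 1"
        using z j by (auto simp: Omega_s_R3_def constr_b_le_def)
      then have "card {k \<in> {1..p}. s k j = 1} < j"
        using sum_zero_one_eq_card[of "{1..p}" "\<lambda>k. s k j"] s01 by simp
      then have "card {k \<in> {1..p}. s k j = 1} < card ({1..p} \<inter> {k. r k \<le> r i})"
        unfolding ri using False by linarith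
      then have "\<not> {1..p} \<inter> {k. r k \<le> r i} \<subseteq> {k \<in> {1..p}. s k j = 1}"
        by (intro notI) (drule card_mono[rotated], auto)
      then obtain k where k: "k \<in> {1..p}" "r k \<le> r i" "s k j \<noteq> 1"
        by blast
      then have "s k j = 0"
        using s01 by blast
      then have "C i \<bullet> x \<le> \<theta> j"
        using d[OF k(1)] r(2)[OF i k(1,2)] by simp
      moreover have "s' i j = 0"
        using False i j by (simp add: s'_def incidence_apply)
      ultimately show ?thesis
        by simp
    qed
  qed
  ultimately show ?thesis
    by blast
qed

section \<open>Transfer of optimality along domination\<close>

lemma objective_mono:
  assumes "\<forall>j\<in>{1..p}. 0 \<le> \<omega> j" "\<forall>j\<in>{1..p}. \<theta>' j \<le> \<theta> j"
  shows "objective p \<omega> (x', s', \<theta>') \<le> objective p \<omega> (x, s, \<theta>)"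
  using assms by (auto simp: objective_def intro!: sum_mono mult_left_mono)

lemma optimal_iff:
  "optimal p \<omega> A z \<longleftrightarrow> z \<in> A \<and> (\<forall>y\<in>A. objective p \<omega> z \<le> objective p \<omega> y)"
  by (auto simp: optimal_def is_arg_min_linorder)

text \<open>Each point of \<open>B\<close> is no better than some point of \<open>A\<close>, which
  in turn is no better than \<open>z\<close>.\<close>

lemma optimal_in_dominated_superset:
  assumes "A \<subseteq> B" "\<And>z. z \<in> B \<Longrightarrow> \<exists>z'\<in>A. objective p \<omega> z' \<le> objective p \<omega> z"
    "optimal p \<omega> A z"
  shows "optimal p \<omega> B z"
  using assms unfolding optimal_iff by (meson order_trans subsetD)

lemma optimal_dominating:
  assumes w: "\<forall>j\<in>{1..p}. 0 \<le> \<omega> j" and sub: "A \<subseteq> B" and opt: "optimal p \<omega> B (x, s, \<theta>)"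
    and mem: "(x', s', \<theta>') \<in> A" and le: "\<forall>j\<in>{1..p}. \<theta>' j \<le> \<theta> j"
  shows "optimal p \<omega> A (x', s', \<theta>')" and "\<forall>j\<in>{1..p}. \<omega> j > 0 \<longrightarrow> \<theta>' j = \<theta> j"
proof -
  have least: "objective p \<omega> (x, s, \<theta>) \<le> objective p \<omega> z" if "z \<in> B" for z
    using opt that unfolding optimal_iff by blast
  show "optimal p \<omega> A (x', s', \<theta>')"
    unfolding optimal_iff
  proof (intro conjI ballI mem)
    fix y assume "y \<in> A"
    then have "objective p \<omega> (x, s, \<theta>) \<le> objective p \<omega> y"
      using sub least by blast
    with objective_mono[OF w le] show "objective p \<omega> (x', s', \<theta>') \<le> objective p \<omega> y"
      by (rule order_trans)
  qed
  \<comment> \<open>The dominating point also lies in \<open>B\<close>, so it cannot have a smaller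
    objective. The differences are non-negative with a sum of at most 0, so each vanishes, and a
    positive weight can be cancelled.\<close>
  have "(\<Sum>j\<in>{1..p}. \<omega> j * (\<theta> j - \<theta>' j)) \<le> 0"
    using least[of "(x', s', \<theta>')"] sub mem
    by (auto simp: objective_def right_diff_distrib sum_subtractf)
  moreover have nonneg: "0 \<le> \<omega> j * (\<theta> j - \<theta>' j)" if "j \<in> {1..p}" for j
    using w le that by simp
  ultimately have "(\<Sum>j\<in>{1..p}. \<omega> j * (\<theta> j - \<theta>' j)) = 0"
    by (intro order_antisym sum_nonneg)
  then have "\<forall>j\<in>{1..p}. \<omega> j * (\<theta> j - \<theta>' j) = 0"
    using nonneg by (subst (asm) sum_nonneg_eq_0_iff) auto
  then show "\<forall>j\<in>{1..p}. \<omega> j > 0 \<longrightarrow> \<theta>' j = \<theta> j"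
    by auto
qed

section \<open>Strictness of the inclusions\<close>

text \<open>A strictly increasing choice of \<open>\<theta>\<close>, so large that (d) holds for every \<open>s\<close>.\<close>

definition large_theta :: "nat \<Rightarrow> (nat \<Rightarrow> real ^ 'n) \<Rightarrow> real ^ 'n \<Rightarrow> nat \<Rightarrow> real" where
  "large_theta p C x = (\<lambda>j\<in>{1..p}. (\<Sum>i\<in>{1..p}. \<bar>C i \<bullet> x\<bar>) + real j)"

text \<open>The sum of absolute values bounds every single cost, and neither \<open>real j\<close>
  nor \<open>M * s i j\<close> is negative.\<close>

lemma constr_d_large_theta:
  assumes "0 \<le> M" "s \<in> {1..p} \<rightarrow>\<^sub>E {1..p} \<rightarrow>\<^sub>E {0, 1}"
  shows "constr_d p C M x s (large_theta p C x)"
  unfolding constr_d_def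
proof (intro ballI)
  fix i j assume ij: "i \<in> {1..p}" "j \<in> {1..p}"
  have "\<bar>C i \<bullet> x\<bar> \<le> (\<Sum>i\<in>{1..p}. \<bar>C i \<bullet> x\<bar>)"
    using ij by (intro member_le_sum) auto
  moreover have "s i j \<in> {0, 1}"
    using assms(2) ij by (metis PiE_mem)
  then have "0 \<le> M * s i j"
    using assms(1) by auto
  ultimately show "C i \<bullet> x \<le> large_theta p C x j + M * s i j"
    using ij by (simp add: large_theta_def)
qed

lemma large_theta_in_domain_s:
  assumes "x \<in> Q"
  shows "(x, incidence p A, large_theta p C x) \<in> domain_s p Q"
  using assms by (simp add: domain_s_def incidence_mem large_theta_def)

lemma card_below:
  assumes "j \<in> {1..p}"
  shows "card ({1..p} \<inter> {i. i < j}) = j - 1"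
proof -
  have "{1..p} \<inter> {i. i < j} = {1..<j}"
    using assms by auto
  then show ?thesis
    by simp
qed

lemma Omega_s_psubset_R1:
  assumes "0 \<le> M" "Q \<noteq> {}" "2 \<le> p"
  shows "Omega_s p Q C M \<subset> Omega_s_R1 p Q C M"
proof -
  obtain x where x: "x \<in> Q"
    using assms(2) by blast
  \<comment> \<open>Any matrix with (b) and (c) would do, since \<open>large_theta\<close> takes
    care of (d); the increasing \<theta> then breaks (e) at \<open>j = 1\<close>.\<close>
  let ?s = "incidence p (\<lambda>j. {i. i < j})"
  let ?z = "(x, ?s, large_theta p C x)"
  have "constr_b p ?s"
    by (intro constr_b_incidence card_below)
  moreover have "constr_c p ?s"
    by (auto simp: constr_c_def incidence_apply)
  ultimately have "?z \<in> Omega_s_R1 p Q C M"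
    using assms(1) x
    by (simp add: Omega_s_R1_def large_theta_in_domain_s constr_d_large_theta incidence_mem)
  moreover have "\<not> constr_e p (large_theta p C x)"
    using assms(3) unfolding constr_e_def
    by (intro notI) (drule bspec[of _ _ 1], auto simp: large_theta_def)
  then have "?z \<notin> Omega_s p Q C M"
    by (simp add: Omega_s_def)
  ultimately show ?thesis
    using Omega_s_subset_R1 by blast
qed

lemma Omega_s_R1_psubset_R2:
  assumes "0 \<le> M" "Q \<noteq> {}" "3 \<le> p"
  shows "Omega_s_R1 p Q C M \<subset> Omega_s_R2 p Q C M"
proof -
  obtain x where x: "x \<in> Q"
    using assms(2) by blast
  \<comment> \<open>Column 2 keeps its single one, but in row \<open>p\<close>. Column 3 marks only
    rows 1 and 2, so for \<open>3 \<le> p\<close> row \<open>p\<close> drops from 1 to 0 and (c)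
    fails.\<close>
  let ?s = "incidence p (\<lambda>j. if j = 2 then {p} else {i. i < j})"
  let ?z = "(x, ?s, large_theta p C x)"
  have "constr_b p ?s"
    using assms(3) card_below by (intro constr_b_incidence) auto
  then have "?z \<in> Omega_s_R2 p Q C M"
    using assms(1) x
    by (simp add: Omega_s_R2_def large_theta_in_domain_s constr_d_large_theta incidence_mem)
  moreover have "\<not> constr_c p ?s"
  proof
    assume "constr_c p ?s"
    moreover have "p \<in> {1..p}" "2 \<in> {1..p}" "2 < p"
      using assms(3) by auto
    ultimately have "?s p (2 + 1) - ?s p 2 \<ge> 0"
      unfolding constr_c_def by blast
    then show False
      using assms(3) by (simp add: incidence_apply)
  qed
  then have "?z \<notin> Omega_s_R1 p Q C M"
    by (simp add: Omega_s_R1_def)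
  ultimately show ?thesis
    using Omega_s_R1_subset_R2 by blast
qed

lemma Omega_s_R2_psubset_R3:
  assumes "0 \<le> M" "Q \<noteq> {}" "2 \<le> p"
  shows "Omega_s_R2 p Q C M \<subset> Omega_s_R3 p Q C M"
proof -
  obtain x where x: "x \<in> Q"
    using assms(2) by blast
  \<comment> \<open>The zero matrix meets every upper bound on the column sums, but (b) asks for the
    sum 1 in column 2.\<close>
  let ?s = "incidence p (\<lambda>j. {})"
  let ?z = "(x, ?s, large_theta p C x)"
  have "constr_b_le p ?s"
    by (auto simp: constr_b_le_def sum_incidence)
  then have "?z \<in> Omega_s_R3 p Q C M"
    using assms(1) x
    by (simp add: Omega_s_R3_def large_theta_in_domain_s constr_d_large_theta incidence_mem)
  moreover have "\<not> constr_b p ?s"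
    using assms(3) unfolding constr_b_def
    by (intro notI) (drule bspec[of _ _ 2], auto simp: sum_incidence)
  then have "?z \<notin> Omega_s_R2 p Q C M"
    by (simp add: Omega_s_R2_def)
  ultimately show ?thesis
    using Omega_s_R2_subset_R3 by blast
qed

text \<open>The conditions for strictness are sharp: for empty \<open>Q\<close> all four sets are
  empty; for \<open>p \<le> 2\<close> constraint (b) makes column 1 zero and so implies (c); for
  \<open>p \<le> 1\<close> constraint (e) is void and the relaxed (b) is equivalent to (b).\<close>

theorem mainTheorem7:
  fixes p :: nat and Q :: "(real ^ 'n) set" and C :: "nat \<Rightarrow> real ^ 'n"
    and \<omega> :: "nat \<Rightarrow> real" and M :: real
  assumes weights: "\<forall>j\<in>{1..p}. 0 \<le> \<omega> j"
    and M_nonneg: "0 \<le> M"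
    and M_bound: "\<forall>x\<in>Q. \<forall>i\<in>{1..p}. C i \<bullet> x \<le> M"
  shows
    "((\<forall>x s \<theta>. optimal p \<omega> (Omega_s_R1 p Q C M) (x, s, \<theta>) \<longrightarrow>
          (\<exists>\<theta>'. optimal p \<omega> (Omega_s p Q C M) (x, s, \<theta>') \<and>
             (\<forall>j\<in>{1..p}. \<omega> j > 0 \<longrightarrow> \<theta>' j = \<theta> j))) \<and>
      (\<forall>z. optimal p \<omega> (Omega_s p Q C M) z \<longrightarrow> optimal p \<omega> (Omega_s_R1 p Q C M) z))
   \<and> ((\<forall>x s \<theta>. optimal p \<omega> (Omega_s_R2 p Q C M) (x, s, \<theta>) \<longrightarrow>
          (\<exists>s' \<theta>'. optimal p \<omega> (Omega_s p Q C M) (x, s', \<theta>') \<and>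
             (\<forall>j\<in>{1..p}. \<omega> j > 0 \<longrightarrow> \<theta>' j = \<theta> j))) \<and>
      (\<forall>z. optimal p \<omega> (Omega_s p Q C M) z \<longrightarrow> optimal p \<omega> (Omega_s_R2 p Q C M) z))
   \<and> ((\<forall>x s \<theta>. optimal p \<omega> (Omega_s_R3 p Q C M) (x, s, \<theta>) \<longrightarrow>
          (\<exists>s' \<theta>'. optimal p \<omega> (Omega_s p Q C M) (x, s', \<theta>') \<and>
             (\<forall>j\<in>{1..p}. \<omega> j > 0 \<longrightarrow> \<theta>' j = \<theta> j))) \<and>
      (\<forall>z. optimal p \<omega> (Omega_s p Q C M) z \<longrightarrow> optimal p \<omega> (Omega_s_R3 p Q C M) z))
   \<and> (Omega_s p Q C M \<subseteq> Omega_s_R1 p Q C M \<and>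
      Omega_s_R1 p Q C M \<subseteq> Omega_s_R2 p Q C M \<and>
      Omega_s_R2 p Q C M \<subseteq> Omega_s_R3 p Q C M \<and>
      (Q \<noteq> {} \<and> 2 \<le> p \<longrightarrow> Omega_s p Q C M \<subset> Omega_s_R1 p Q C M) \<and>
      (Q \<noteq> {} \<and> 3 \<le> p \<longrightarrow> Omega_s_R1 p Q C M \<subset> Omega_s_R2 p Q C M) \<and>
      (Q \<noteq> {} \<and> 2 \<le> p \<longrightarrow> Omega_s_R2 p Q C M \<subset> Omega_s_R3 p Q C M))"
proof -
  let ?O = "Omega_s p Q C M"
  have sub2: "?O \<subseteq> Omega_s_R2 p Q C M" and sub3: "?O \<subseteq> Omega_s_R3 p Q C M"
    using Omega_s_subset_R1 Omega_s_R1_subset_R2 Omega_s_R2_subset_R3 by blast+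
  have dom: "\<exists>z'\<in>?O. objective p \<omega> z' \<le> objective p \<omega> z"
    if zR3: "z \<in> Omega_s_R3 p Q C M" for z
  proof -
    obtain x s \<theta> where z: "z = (x, s, \<theta>)"
      by (rule prod_cases3)
    then obtain s' \<theta>' where "(x, s', \<theta>') \<in> ?O" "\<forall>j\<in>{1..p}. \<theta>' j \<le> \<theta> j"
      using Omega_s_R3_dominated[OF M_nonneg] zR3 by blast
    then show ?thesis
      using objective_mono[OF weights] z by blast
  qed
  \<comment> \<open>Every relaxation lies between \<open>?O\<close> and the weakest one, so
    domination over the latter serves all three.\<close>
  have conv: "optimal p \<omega> B z" if "?O \<subseteq> B" "B \<subseteq> Omega_s_R3 p Q C M" "optimal p \<omega> ?O z" for B z
    using that dom by (intro optimal_in_dominated_superset[of ?O B]) blast+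
  have restore: "\<exists>s' \<theta>'. optimal p \<omega> ?O (x, s', \<theta>') \<and> (\<forall>j\<in>{1..p}. \<omega> j > 0 \<longrightarrow> \<theta>' j = \<theta> j)"
    if B: "?O \<subseteq> B" "B \<subseteq> Omega_s_R3 p Q C M" "optimal p \<omega> B (x, s, \<theta>)" for B x s \<theta>
  proof -
    have "(x, s, \<theta>) \<in> Omega_s_R3 p Q C M"
      using B(2,3) by (auto simp: optimal_iff)
    then obtain s' \<theta>' where "(x, s', \<theta>') \<in> ?O" "\<forall>j\<in>{1..p}. \<theta>' j \<le> \<theta> j"
      using Omega_s_R3_dominated[OF M_nonneg] by blast
    from optimal_dominating[OF weights B(1,3) this] show ?thesis
      by blast
  qed
  \<comment> \<open>R1 needs its own version because its conclusion keeps \<open>s\<close>, whereas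
    \<open>restore\<close> may replace it.\<close>
  have restore1: "\<exists>\<theta>'. optimal p \<omega> ?O (x, s, \<theta>') \<and> (\<forall>j\<in>{1..p}. \<omega> j > 0 \<longrightarrow> \<theta>' j = \<theta> j)"
    if opt: "optimal p \<omega> (Omega_s_R1 p Q C M) (x, s, \<theta>)" for x s \<theta>
  proof -
    have "(x, s, \<theta>) \<in> Omega_s_R1 p Q C M"
      using opt by (auto simp: optimal_iff)
    then obtain \<theta>' where "(x, s, \<theta>') \<in> ?O" "\<forall>j\<in>{1..p}. \<theta>' j \<le> \<theta> j"
      using Omega_s_R1_dominated[OF M_nonneg] by blast
    from optimal_dominating[OF weights Omega_s_subset_R1 opt this] show ?thesis
      by blast
  qed
  have sub13: "Omega_s_R1 p Q C M \<subseteq> Omega_s_R3 p Q C M"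
    using Omega_s_R1_subset_R2 Omega_s_R2_subset_R3 by blast
  show ?thesis
    by (intro conjI allI impI; (elim conjE)?;
        (rule Omega_s_subset_R1 Omega_s_R1_subset_R2 Omega_s_R2_subset_R3
          Omega_s_psubset_R1[OF M_nonneg] Omega_s_R1_psubset_R2[OF M_nonneg]
          Omega_s_R2_psubset_R3[OF M_nonneg]
          restore1 restore[OF sub2 Omega_s_R2_subset_R3] restore[OF sub3 order_refl]
          conv[OF Omega_s_subset_R1 sub13] conv[OF sub2 Omega_s_R2_subset_R3]
          conv[OF sub3 order_refl]; assumption))
qed

end
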